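(* Let $m\ge2$ be an integer, let $f\in\mathcal F_m$, and let $G$ be a finite abelian group whose exponent divides $m$. Then for every subset $A\subseteq G$ and every generating subset $S\subseteq G$, $$\partial_S(A)\ge \frac1m\,|G|\,f(|A|/|G|).$$
   Context: For subsets $S,A$ of a finite abelian group $G$, $\partial_S(A):=|\{(a,s)\in A\times S:\ a+s\notin A\}|$. For an integer $m\ge2$, $\mathcal F_m$ is the class of all functions $f:[0,1]\to\mathbb R$ such that $\max\{f(0),f(1)\}\le0$ and such that for all $x_1,\dots,x_m\in[0,1]$ with $\min_ix_i=x_1$ and $\max_ix_i=x_m$, $$f\Big(\frac{x_1+\dots+x_m}{m}\Big)\le\frac{f(x_1)+\dots+f(x_m)}{m}+(x_m-x_1).$$ *)

theory Defs
  imports Complex_Main "HOL-Algebra.Generated_Groups"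
begin

definition edge_boundary :: "('a, 'b) monoid_scheme \<Rightarrow> 'a set \<Rightarrow> 'a set \<Rightarrow> nat" where
  "edge_boundary G S A = card {(a, s) \<in> A \<times> S. a \<otimes>\<^bsub>G\<^esub> s \<notin> A}"

(* Intended for groups with bounded element orders, e.g. finite ones; otherwise the value of LEAST is
   unspecified. *)
definition group_exponent :: "('a, 'b) monoid_scheme \<Rightarrow> nat" where
  "group_exponent G = (LEAST n. 0 < n \<and> (\<forall>x \<in> carrier G. x [^]\<^bsub>G\<^esub> n = \<one>\<^bsub>G\<^esub>))"

(* A function on the unit interval is represented by a total function of which only the values on
   {0..1} are constrained; likewise only the values x 1, ..., x m of the sequence x are used. *)
definition class_F :: "nat \<Rightarrow> (real \<Rightarrow> real) set" where
  "class_F m = {f. max (f 0) (f 1) \<le> 0 \<and>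
     (\<forall>x :: nat \<Rightarrow> real.
        (\<forall>i \<in> {1..m}. x i \<in> {0..1}) \<and>
        Min (x ` {1..m}) = x 1 \<and> Max (x ` {1..m}) = x m \<longrightarrow>
        f ((\<Sum>i = 1..m. x i) / real m) \<le> (\<Sum>i = 1..m. f (x i)) / real m + (x m - x 1))}"

end

theory Submission
  imports Defs "HOL-Library.Multiset" "HOL-Algebra.Multiplicative_Group"
begin

text \<open>
  Induction on the generating set. Passing from \<open>H = \<langle>S\<rangle>\<close> to \<open>K = \<langle>S \<union> {s}\<rangle>\<close>, the cosets
  \<open>s\<^sup>i H\<close> with \<open>i < m\<close> cover every element of \<open>K\<close> equally often, say \<open>r\<close> times, because
  \<open>s\<^sup>m = 1\<close>. Let \<open>y\<^sub>i\<close> be the density of \<open>A\<close> in \<open>s\<^sup>i H\<close>. Counted \<open>r\<close> times, the edges in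
  directions from \<open>S\<close> are bounded below by the induction hypothesis in each coset, while the edges
  in direction \<open>s\<close> number at least \<open>|H|\<close> times the total descent of the cyclic sequence
  \<open>y\<^sub>0, \<dots>, y\<^sub>m = y\<^sub>0\<close>, hence at least \<open>|H| (max y - min y)\<close>. The defining inequality of
  \<open>\<F>\<^sub>m\<close> at the points \<open>y\<^sub>i\<close> and the identity \<open>r |K| = m |H|\<close> close the induction.
\<close>

section \<open>Inequalities for means and cyclic sequences of reals\<close>

text \<open>The definition of \<open>class_F\<close> speaks only of sequences with their minimum
  first and maximum last. Both means are invariant under permutation, so sorting brings an arbitrary
  \<open>y\<close> into this form; its extreme entries are then values \<open>y p\<close> and
  \<open>y q\<close>.\<close>

lemma class_F_mean:
  fixes y :: "nat \<Rightarrow> real"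
  assumes "f \<in> class_F m" "m \<ge> 1" "\<And>i. i < m \<Longrightarrow> y i \<in> {0..1}"
  obtains p q where "p < m" "q < m"
    "f ((\<Sum>i<m. y i) / m) \<le> (\<Sum>i<m. f (y i)) / m + (y q - y p)"
proof -
  define L where "L = sort (map y [0..<m])"
  define x where "x i = L ! (i - 1)" for i
  have len: "length L = m" and srt: "sorted L" and mset_L: "mset L = mset (map y [0..<m])"
    by (simp_all add: L_def)
  have in_range: "\<exists>p<m. L ! i = y p" if "i < m" for i
    using nth_mem[of i L] that len by (auto simp: L_def)
  have sums: "(\<Sum>i = 1..m. g (x i)) = (\<Sum>i<m. g (y i))" for g :: "real \<Rightarrow> real"
  proof -
    have "(\<Sum>i = 1..m. g (x i)) = (\<Sum>i<m. g (L ! i))"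
      by (rule sum.reindex_bij_witness[of _ Suc "\<lambda>i. i - 1"]) (auto simp: x_def)
    also have "\<dots> = sum_list (map g L)"
      by (simp add: sum_list_sum_nth len atLeast0LessThan)
    also have "\<dots> = sum_list (map g (map y [0..<m]))"
      by (metis mset_L mset_map sum_mset_sum_list)
    also have "\<dots> = (\<Sum>i<m. g (y i))"
      by (simp add: sum_list_sum_nth atLeast0LessThan)
    finally show ?thesis .
  qed
  have unit: "\<forall>i\<in>{1..m}. x i \<in> {0..1}"
  proof
    fix i assume "i \<in> {1..m}"
    then have "i - 1 < m" by auto
    then obtain p where "p < m" "x i = y p" using in_range[of "i - 1"] unfolding x_def by blast
    then show "x i \<in> {0..1}" using assms(3) by simp
  qed
  have "x 1 \<le> x i" "x i \<le> x m" if "i \<in> {1..m}" for i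
    using that srt len by (auto simp: x_def intro!: sorted_nth_mono)
  then have "Min (x ` {1..m}) = x 1" "Max (x ` {1..m}) = x m"
    using \<open>m \<ge> 1\<close> by (auto intro!: Min_eqI Max_eqI)
  then have "f ((\<Sum>i = 1..m. x i) / m) \<le> (\<Sum>i = 1..m. f (x i)) / m + (x m - x 1)"
    using assms(1) unit unfolding class_F_def by blast
  moreover obtain p q where "p < m" "q < m" "x 1 = y p" "x m = y q"
    using in_range[of 0] in_range[of "m - 1"] \<open>m \<ge> 1\<close> by (auto simp: x_def)
  ultimately show ?thesis
    using that sums[of f] sums[of "\<lambda>t. t"] by simp
qed

text \<open>Walking around the cycle from index \<open>q\<close> forward to index \<open>p\<close>,
  the value falls by \<open>b q - b p\<close> in total, and the \<open>d i\<close> met on the way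
  dominate the individual falls.\<close>

lemma cyclic_descent_bound:
  fixes b d :: "nat \<Rightarrow> real"
  assumes "b m = b 0" "p < m" "q < m"
    and d: "\<And>i. d i \<ge> 0" "\<And>i. d i \<ge> b i - b (Suc i)"
  shows "b q - b p \<le> (\<Sum>i<m. d i)"
proof -
  have tel: "b u - b v \<le> (\<Sum>i=u..<v. d i)" if "u \<le> v" for u v
    using that
  proof (induction v rule: dec_induct)
    case (step n)
    then show ?case using d(2)[of n] by simp
  qed simp
  show ?thesis
  proof (cases "q \<le> p")
    case True
    have "(\<Sum>i=q..<p. d i) \<le> (\<Sum>i<m. d i)"
      using assms by (intro sum_mono2) auto
    then show ?thesis using tel[OF True] by linarith
  next
    case False
    \<comment> \<open>For \<open>p < q\<close> the walk wraps around at \<open>m\<close>, where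
      \<open>b m = b 0\<close> joins its two pieces.\<close>
    have "b q - b p \<le> (\<Sum>i=q..<m. d i) + (\<Sum>i=0..<p. d i)"
      using tel[of q m] tel[of 0 p] assms by simp
    also have "\<dots> = (\<Sum>i\<in>{q..<m} \<union> {0..<p}. d i)"
      using False by (subst sum.union_disjoint) auto
    also have "\<dots> \<le> (\<Sum>i<m. d i)"
      using assms False by (intro sum_mono2) auto
    finally show ?thesis .
  qed
qed

section \<open>Edge boundary by direction, and the exponent\<close>

lemma edge_boundary_eq_sum:
  assumes "finite S" "finite A"
  shows "edge_boundary G S A = (\<Sum>s\<in>S. card {a \<in> A. a \<otimes>\<^bsub>G\<^esub> s \<notin> A})"
proof -
  have "{(a, s) \<in> A \<times> S. a \<otimes>\<^bsub>G\<^esub> s \<notin> A} = prod.swap ` (SIGMA s:S. {a \<in> A. a \<otimes>\<^bsub>G\<^esub> s \<notin> A})"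
    by force
  then show ?thesis
    using assms by (simp add: edge_boundary_def card_image)
qed

lemma (in group) pow_group_exponent:
  assumes "finite (carrier G)" "x \<in> carrier G"
  shows "x [^] group_exponent G = \<one>"
proof -
  \<comment> \<open>The group order witnesses that the \<open>LEAST\<close> in
    \<open>group_exponent\<close> is attained.\<close>
  have "0 < order G \<and> (\<forall>x\<in>carrier G. x [^] order G = \<one>)"
    using assms by (simp add: order_gt_0_iff_finite pow_order_eq_1)
  from LeastI[of "\<lambda>n. 0 < n \<and> (\<forall>x\<in>carrier G. x [^] n = \<one>)", OF this]
  show ?thesis using assms unfolding group_exponent_def by blast
qed

section \<open>Multiplicity of the covering by cosets of powers of one element\<close>

context comm_group
begin

lemma card_translate_into:
  assumes "finite Q" "x \<in> carrier G" "H \<subseteq> carrier G"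
  shows "card {h \<in> H. x \<otimes> h \<in> Q} = (\<Sum>g\<in>Q. of_bool (g \<in> x <# H))"
proof -
  have "(\<otimes>) x ` {h \<in> H. x \<otimes> h \<in> Q} = Q \<inter> (x <# H)"
    by (auto simp: l_coset_def)
  moreover have "inj_on ((\<otimes>) x) {h \<in> H. x \<otimes> h \<in> Q}"
    using assms by (intro inj_on_subset[OF inj_on_cmult]) auto
  ultimately have "card {h \<in> H. x \<otimes> h \<in> Q} = card (Q \<inter> (x <# H))"
    by (metis card_image)
  then show ?thesis using assms by (simp add: sum_of_bool_eq)
qed

lemma mem_l_coset_iff:
  assumes "subgroup H G" "x \<in> carrier G" "g \<in> carrier G"
  shows "g \<in> x <# H \<longleftrightarrow> inv x \<otimes> g \<in> H"
proof
  assume "g \<in> x <# H"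
  then obtain h where "h \<in> H" "g = x \<otimes> h" by (auto simp: l_coset_def)
  then show "inv x \<otimes> g \<in> H"
    using assms subgroup.mem_carrier[OF assms(1)] by (simp add: m_assoc[symmetric])
next
  assume "inv x \<otimes> g \<in> H"
  moreover have "g = x \<otimes> (inv x \<otimes> g)" using assms by (simp add: m_assoc[symmetric])
  ultimately show "g \<in> x <# H" by (auto simp: l_coset_def)
qed

text \<open>Cosets are counted with multiplicity: they repeat when the order of \<open>s\<close>
  modulo \<open>H\<close> is less than \<open>m\<close>, and this order never has to be
  named.\<close>

definition coset_cover_count :: "'a set \<Rightarrow> 'a \<Rightarrow> nat \<Rightarrow> 'a \<Rightarrow> nat" where
  "coset_cover_count H s m g = (\<Sum>i<m. of_bool (g \<in> (s [^] i) <# H))"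

text \<open>Multiplying \<open>g\<close> by \<open>s\<close> merely rotates the summands, since it
  moves the coset of \<open>s [^] i\<close> to that of \<open>s [^] Suc i\<close>; the hypothesis
  \<open>s [^] m = \<one>\<close> closes the cycle.\<close>

lemma coset_cover_count_mult_generator:
  assumes "subgroup H G" "s \<in> carrier G" "s [^] m = \<one>" "g \<in> carrier G"
  shows "coset_cover_count H s m (g \<otimes> s) = coset_cover_count H s m g"
proof -
  define F :: "nat \<Rightarrow> nat" where "F i = of_bool (g \<otimes> s \<in> (s [^] i) <# H)" for i
  have "inv (s [^] Suc i) \<otimes> (g \<otimes> s) = inv (s [^] i) \<otimes> g" for i
    using assms by (simp add: inv_mult m_ac) (simp add: m_assoc[symmetric])
  then have shift: "F (Suc i) = of_bool (g \<in> (s [^] i) <# H)" for i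
    using assms by (simp add: F_def mem_l_coset_iff del: nat_pow_Suc)
  have "F m = F 0" using assms by (simp add: F_def)
  then have "(\<Sum>i<m. F (Suc i)) = (\<Sum>i<m. F i)"
    using sum.lessThan_Suc_shift[of F m] by simp
  then show ?thesis by (simp add: coset_cover_count_def shift) (simp add: F_def)
qed

lemma coset_cover_count_mult_subgroup:
  assumes "subgroup H G" "s \<in> carrier G" "g \<in> carrier G" "h \<in> H"
  shows "coset_cover_count H s m (g \<otimes> h) = coset_cover_count H s m g"
proof -
  have h: "h \<in> carrier G" using subgroup.mem_carrier[OF assms(1,4)] .
  have "inv (s [^] i) \<otimes> (g \<otimes> h) \<in> H \<longleftrightarrow> inv (s [^] i) \<otimes> g \<in> H" for i :: nat
  proof -
    have "(inv (s [^] i) \<otimes> g) \<otimes> h \<in> H \<longleftrightarrow> inv (s [^] i) \<otimes> g \<in> H"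
    proof
      assume "(inv (s [^] i) \<otimes> g) \<otimes> h \<in> H"
      then have "(inv (s [^] i) \<otimes> g) \<otimes> h \<otimes> inv h \<in> H"
        by (rule subgroup.m_closed[OF assms(1) _ subgroup.m_inv_closed[OF assms(1,4)]])
      then show "inv (s [^] i) \<otimes> g \<in> H"
        using assms(2,3) h by (simp add: m_assoc)
    qed (simp add: subgroup.m_closed[OF assms(1)] assms(4))
    then show ?thesis using assms h by (simp add: m_assoc)
  qed
  then show ?thesis using assms h by (simp add: coset_cover_count_def mem_l_coset_iff)
qed

lemma coset_cover_count_constant:
  assumes "S \<subseteq> carrier G" "s \<in> carrier G" "s [^] m = \<one>" "g \<in> generate G (insert s S)"
  shows "coset_cover_count (generate G S) s m g = coset_cover_count (generate G S) s m \<one>"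
proof -
  let ?N = "coset_cover_count (generate G S) s m"
  have H: "subgroup (generate G S) G" using assms by (simp add: generate_is_subgroup)
  have car: "u \<in> carrier G" if "u \<in> insert s S" for u using that assms by auto
  have gen: "?N (g \<otimes> u) = ?N g" if "u \<in> insert s S" "g \<in> carrier G" for u g
  proof (cases "u = s")
    case True
    then show ?thesis
      using coset_cover_count_mult_generator[OF H assms(2,3) that(2)] by simp
  next
    case False
    then have "u \<in> generate G S" using that(1) by (auto intro: generate.incl)
    then show ?thesis by (rule coset_cover_count_mult_subgroup[OF H assms(2) that(2)])
  qed
  \<comment> \<open>Quantifying over all \<open>g\<close> lets the product case chain two
    invariances, and the inverse case use invariance under \<open>u\<close> at
    \<open>g \<otimes> inv u\<close>.\<close>
  have "u \<in> carrier G \<and> (\<forall>g\<in>carrier G. ?N (g \<otimes> u) = ?N g)"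
    if "u \<in> generate G (insert s S)" for u
    using that
  proof induction
    case (inv u)
    have "?N (g \<otimes> inv u) = ?N g" if "g \<in> carrier G" for g
    proof -
      have "g \<otimes> inv u \<otimes> u = g" using car[OF inv] that by (simp add: m_assoc)
      then show ?thesis using gen[OF inv, of "g \<otimes> inv u"] car[OF inv] that by simp
    qed
    then show ?case using car[OF inv] by simp
  next
    case (eng u v)
    then show ?case by (simp add: m_assoc[symmetric])
  qed (use gen car in auto)
  from this[OF assms(4)] have "g \<in> carrier G" "?N (\<one> \<otimes> g) = ?N \<one>" by blast+
  then show ?thesis by simp
qed

section \<open>Induction on the generating set\<close>

text \<open>Subsets of a generating set need not generate \<open>G\<close>, so the bound is relative
  to \<open>generate G S\<close>. The set \<open>A\<close> stays arbitrary because the induction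
  hypothesis is applied to every coset slice of it.\<close>

lemma edge_boundary_generate_bound:
  assumes f: "f \<in> class_F m" and m: "m \<ge> 1"
    and fin: "finite (carrier G)" and exponent: "\<And>x. x \<in> carrier G \<Longrightarrow> x [^] m = \<one>"
    and "finite S" "S \<subseteq> carrier G" "A \<subseteq> generate G S"
  shows "real (edge_boundary G S A)
    \<ge> 1 / m * card (generate G S) * f (card A / card (generate G S))"
  using \<open>finite S\<close> assms(6,7)
proof (induction S arbitrary: A rule: finite_induct)
  case empty
  then have "A = {} \<or> A = {\<one>}" by (auto simp: generate_empty)
  \<comment> \<open>The density of \<open>A\<close> in the trivial group is 0 or 1, where
    \<open>f\<close> is nonpositive.\<close>
  moreover have "f 0 \<le> 0" "f 1 \<le> 0" using f by (auto simp: class_F_def)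
  ultimately show ?case
    using m by (auto simp: generate_empty edge_boundary_def divide_le_0_iff)
next
  case (insert s S)
  define H where "H = generate G S"
  define K where "K = generate G (insert s S)"
  define r where "r = coset_cover_count H s m \<one>"
  \<comment> \<open>\<open>B i\<close> is the part of \<open>A\<close> in the coset of
    \<open>s [^] i\<close>, translated back into \<open>H\<close>; \<open>D t\<close> collects the
    starting points of boundary edges in direction \<open>t\<close>.\<close>
  define B where "B i = {h \<in> H. s [^] i \<otimes> h \<in> A}" for i :: nat
  define D where "D t = {a \<in> A. a \<otimes> t \<notin> A}" for t
  have s: "s \<in> carrier G" and S: "S \<subseteq> carrier G" using insert.prems by auto
  have subH: "subgroup H G" and subK: "subgroup K G"
    unfolding H_def K_def using s S by (auto intro!: generate_is_subgroup)
  have H: "H \<subseteq> carrier G" and K: "K \<subseteq> carrier G"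
    using subH subK by (auto dest: subgroup.subset)
  have HK: "H \<subseteq> K" unfolding H_def K_def by (rule mono_generate) auto
  have sK: "s [^] i \<in> K" for i :: nat
  proof -
    have "s \<in> K" by (simp add: K_def generate.incl)
    then show ?thesis
      by (induction i) (auto simp: subgroup.one_closed[OF subK] subgroup.m_closed[OF subK])
  qed
  have AK: "A \<subseteq> K" using insert.prems by (simp add: K_def)
  have finH: "finite H" and finK: "finite K" and finA: "finite A"
    using H K AK fin by (auto intro: finite_subset)
  have posH: "card H > 0"
    using finH subgroup.one_closed[OF subH] card_gt_0_iff by blast
  have posK: "card K > 0"
    using finK subgroup.one_closed[OF subK] card_gt_0_iff by blast
  \<comment> \<open>Double counting: each element of \<open>Q\<close> lies in exactly
    \<open>r\<close> of the \<open>m\<close> listed cosets.\<close>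
  have count: "(\<Sum>i<m. card {h \<in> H. s [^] i \<otimes> h \<in> Q}) = r * card Q" if "Q \<subseteq> K" for Q
  proof -
    have "finite Q" using that finK finite_subset by blast
    then have "(\<Sum>i<m. card {h \<in> H. s [^] i \<otimes> h \<in> Q})
        = (\<Sum>i<m. \<Sum>g\<in>Q. of_bool (g \<in> (s [^] i) <# H))"
      using s H by (simp add: card_translate_into)
    also have "\<dots> = (\<Sum>g\<in>Q. coset_cover_count H s m g)"
      unfolding coset_cover_count_def by (rule sum.swap)
    also have "\<dots> = (\<Sum>g\<in>Q. r)"
      using that coset_cover_count_constant[OF S s exponent[OF s]]
      by (intro sum.cong) (auto simp: r_def H_def K_def)
    finally show ?thesis by simp
  qed
  have rK: "m * card H = r * card K"
  proof -
    have "{h \<in> H. s [^] i \<otimes> h \<in> K} = H" for i :: nat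
      using HK sK by (auto intro!: subgroup.m_closed[OF subK])
    then show ?thesis using count[of K] by simp
  qed
  then have rpos: "r > 0" using posH posK m by (cases r) auto
  have rA: "(\<Sum>i<m. card (B i)) = r * card A"
    using count[OF AK] by (simp add: B_def)
  have rD: "(\<Sum>i<m. card {h \<in> H. s [^] i \<otimes> h \<in> D t}) = r * card (D t)" for t
    using count[of "D t"] AK by (auto simp: D_def)
  \<comment> \<open>A direction \<open>t\<close> in \<open>S\<close> stays inside the coset, so
    these edges become boundary edges of \<open>B i\<close> within \<open>H\<close>.\<close>
  have DS: "{h \<in> H. s [^] i \<otimes> h \<in> D t} = {h \<in> B i. h \<otimes> t \<notin> B i}" if "t \<in> S" for i :: nat and t
  proof -
    have t: "t \<in> H" "t \<in> carrier G"
      using that S by (auto simp: H_def generate.incl)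
    have "s [^] i \<otimes> h \<otimes> t = s [^] i \<otimes> (h \<otimes> t)" "h \<otimes> t \<in> H" if "h \<in> H" for h
      using that t s H subgroup.m_closed[OF subH] by (auto simp: m_assoc)
    then show ?thesis by (auto simp: D_def B_def)
  qed
  \<comment> \<open>Direction \<open>s\<close> leads from slice \<open>i\<close> to slice
    \<open>i + 1\<close>; commutativity moves the factor \<open>s\<close> past
    \<open>h\<close>.\<close>
  have Ds: "{h \<in> H. s [^] i \<otimes> h \<in> D s} = B i - B (Suc i)" for i :: nat
  proof -
    have "s [^] i \<otimes> h \<otimes> s = s [^] Suc i \<otimes> h" if "h \<in> H" for h
      using that s H by (auto simp: m_ac)
    then show ?thesis by (auto simp: D_def B_def)
  qed
  have finB: "finite (B i)" for i using finH by (simp add: B_def)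
  have boundary: "r * edge_boundary G (insert s S) A
      = (\<Sum>i<m. card (B i - B (Suc i))) + (\<Sum>i<m. edge_boundary G S (B i))"
  proof -
    have "r * edge_boundary G (insert s S) A = r * card (D s) + (\<Sum>t\<in>S. r * card (D t))"
      using insert.hyps finA
      by (simp add: edge_boundary_eq_sum D_def algebra_simps sum_distrib_left)
    also have "(\<Sum>t\<in>S. r * card (D t)) = (\<Sum>t\<in>S. \<Sum>i<m. card {h \<in> B i. h \<otimes> t \<notin> B i})"
      by (intro sum.cong refl) (simp add: rD[symmetric] DS)
    also have "\<dots> = (\<Sum>i<m. \<Sum>t\<in>S. card {h \<in> B i. h \<otimes> t \<notin> B i})"
      by (rule sum.swap)
    also have "\<dots> = (\<Sum>i<m. edge_boundary G S (B i))"
      using insert.hyps finB by (simp add: edge_boundary_eq_sum)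
    also have "r * card (D s) = (\<Sum>i<m. card (B i - B (Suc i)))"
      by (simp add: rD[symmetric] Ds)
    finally show ?thesis .
  qed
  define y where "y i = card (B i) / card H" for i
  have y: "y i \<in> {0..1}" for i
    using posH card_mono[OF finH, of "B i"] by (auto simp: y_def B_def divide_le_eq_1)
  obtain p q where pq: "p < m" "q < m"
    and fy: "f ((\<Sum>i<m. y i) / m) \<le> (\<Sum>i<m. f (y i)) / m + (y q - y p)"
    using class_F_mean[OF f m, of y] y by blast
  have "(\<Sum>i<m. y i) / m = r * card A / (m * card H)"
    using arg_cong[OF rA, of real] by (simp add: y_def sum_divide_distrib[symmetric] ac_simps)
  also have "\<dots> = card A / card K"
  proof -
    have "real m * card H = r * card K" using arg_cong[OF rK, of real] by simp
    then show ?thesis using rpos by simp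
  qed
  finally have mean: "(\<Sum>i<m. y i) / m = card A / card K" .
  \<comment> \<open>The slice sizes are cyclic because \<open>s [^] m = \<one>\<close>, and the
    edges in direction \<open>s\<close> leaving a slice number at least the drop in size.\<close>
  have descent: "real (card (B q)) - card (B p) \<le> (\<Sum>i<m. real (card (B i - B (Suc i))))"
  proof (rule cyclic_descent_bound[OF _ pq])
    show "real (card (B m)) = card (B 0)" using s exponent by (simp add: B_def)
    show "real (card (B i)) - card (B (Suc i)) \<le> card (B i - B (Suc i))" for i
      using diff_card_le_card_Diff[of "B (Suc i)" "B i"] finB[of "Suc i"] by linarith
  qed simp
  have IH: "1 / m * card H * f (y i) \<le> edge_boundary G S (B i)" for i
    using insert.IH[OF S, of "B i"] by (auto simp: H_def B_def y_def)
  have "card H * f (card A / card K) \<le> card H * ((\<Sum>i<m. f (y i)) / m + (y q - y p))"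
    using fy mean by (intro mult_left_mono) auto
  also have "\<dots> = (\<Sum>i<m. 1 / m * card H * f (y i)) + (real (card (B q)) - card (B p))"
  proof -
    have "card H * ((\<Sum>i<m. f (y i)) / m) = (\<Sum>i<m. 1 / m * card H * f (y i))"
      by (simp add: sum_distrib_left sum_divide_distrib)
    moreover have "card H * (y q - y p) = real (card (B q)) - card (B p)"
      using posH by (simp add: y_def right_diff_distrib)
    ultimately show ?thesis by (simp only: distrib_left)
  qed
  also have "\<dots> \<le> (\<Sum>i<m. real (edge_boundary G S (B i)))
      + (\<Sum>i<m. real (card (B i - B (Suc i))))"
    by (rule add_mono[OF sum_mono[OF IH] descent])
  also have "\<dots> = r * real (edge_boundary G (insert s S) A)"
    using arg_cong[OF boundary, of real] by simp
  finally have main: "card H * f (card A / card K) \<le> r * real (edge_boundary G (insert s S) A)" .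
  \<comment> \<open>By \<open>rK\<close> both sides of \<open>main\<close> carry the factor
    \<open>r\<close>, which cancels.\<close>
  have "real (card H) = r * (1 / m * card K)"
    using arg_cong[OF rK, of real] m by (simp add: field_simps)
  then have "r * (1 / m * card K * f (card A / card K)) \<le> r * real (edge_boundary G (insert s S) A)"
    using main by (simp add: mult.assoc)
  then show ?case
    unfolding K_def[symmetric] by (rule mult_left_le_imp_le) (use rpos in simp)
qed

end

theorem theorem5:
  fixes G :: "('a, 'b) monoid_scheme" and m :: nat and f :: "real \<Rightarrow> real" and A S :: "'a set"
  assumes "m \<ge> 2"
    and "f \<in> class_F m"
    and "comm_group G"
    and "finite (carrier G)"
    and "group_exponent G dvd m"
    and "A \<subseteq> carrier G"
    and "S \<subseteq> carrier G"
    and "generate G S = carrier G"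
  shows "real (edge_boundary G S A)
    \<ge> 1 / real m * real (order G) * f (real (card A) / real (order G))"
proof -
  interpret comm_group G by fact
  have "x [^]\<^bsub>G\<^esub> m = \<one>\<^bsub>G\<^esub>" if "x \<in> carrier G" for x
  proof -
    obtain k where "m = group_exponent G * k" using assms(5) by blast
    then show ?thesis
      using that pow_group_exponent[OF assms(4) that] by (simp add: nat_pow_pow[symmetric])
  qed
  then show ?thesis
    using edge_boundary_generate_bound[of f m S A] assms finite_subset[of S "carrier G"]
    by (simp add: order_def)
qed

end
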